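(* Let $(\mathfrak{g}, [\cdot,\cdot]_{\mathfrak{g}}, \alpha_{\mathfrak{g}}, \langle\cdot,\cdot\rangle)$ be an involutive Riemannian Hom-Lie algebra. (i) If $\mathfrak{g}$ has negative Ricci curvature, i.e. $\mathrm{Ric}(x,x)<0$ for all nonzero $x\in\mathfrak{g}$, then $\mathfrak{g}$ admits no nonzero Killing vector. (ii) If $\mathfrak{g}$ has non-positive Ricci curvature, i.e. $\mathrm{Ric}(x,x)\le 0$ for all $x\in\mathfrak{g}$, then every Killing vector $v\in\mathfrak{g}$ is parallel, i.e. $\nabla_x v=0$ for all $x\in\mathfrak{g}$.
   Context: A Hom-Lie algebra is a triple $(\mathfrak{g},[\cdot,\cdot]_{\mathfrak{g}},\alpha_{\mathfrak{g}})$ where $\mathfrak{g}$ is a (here finite-dimensional real) vector space, $[\cdot,\cdot]_{\mathfrak{g}}:\mathfrak{g}\times\mathfrak{g}\to\mathfrak{g}$ is a skew-symmetric bilinear map, and $\alpha_{\mathfrak{g}}:\mathfrak{g}\to\mathfrak{g}$ is a linear map with $\alpha_{\mathfrak{g}}([x,y]_{\mathfrak{g}})=[\alpha_{\mathfrak{g}}(x),\alpha_{\mathfrak{g}}(y)]_{\mathfrak{g}}$ for all $x,y$, such that the Hom-Jacobi identity $[\alpha_{\mathfrak{g}}(x),[y,z]_{\mathfrak{g}}]_{\mathfrak{g}}+[\alpha_{\mathfrak{g}}(y),[z,x]_{\mathfrak{g}}]_{\mathfrak{g}}+[\alpha_{\mathfrak{g}}(z),[x,y]_{\mathfrak{g}}]_{\mathfrak{g}}=0$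 holds for all $x,y,z\in\mathfrak{g}$. It is involutive if $\alpha_{\mathfrak{g}}^2=\mathrm{Id}_{\mathfrak{g}}$ (in particular $\alpha_{\mathfrak{g}}$ is invertible). A pseudo-Riemannian Hom-Lie algebra is such a triple together with a non-degenerate symmetric bilinear form $\langle\cdot,\cdot\rangle:\mathfrak{g}\times\mathfrak{g}\to\mathbb{R}$ with $\langle\alpha_{\mathfrak{g}}(x),\alpha_{\mathfrak{g}}(y)\rangle=\langle x,y\rangle$ for all $x,y$. It is called Riemannian if $\langle\cdot,\cdot\rangle$ is positive definite. The Hom-Levi-Civita connection is the unique bilinear map $\nabla:\mathfrak{g}\times\mathfrak{g}\to\mathfrak{g}$, $(x,y)\mapsto\nabla_x y$, given by the Koszul formula $$2\langle\nabla_x y,\alpha_{\mathfrak{g}}(z)\rangle=\langle[x,y]_{\mathfrak{g}},\alpha_{\mathfrak{g}}(z)\rangle+\langle[z,y]_{\mathfrak{g}},\alpha_{\mathfrak{g}}(x)\rangle+\langle[z,x]_{\mathfrak{g}},\alpha_{\mathfrak{g}}(y)\rangle$$ for all $x,y,z\in\mathfrak{g}$. It satisfies $[x,y]_{\mathfrak{g}}=\nabla_x y-\nabla_y x$, $\langle\nabla_x y,\alpha_{\mathfrak{g}}(z)\rangle=-\langle\alpha_{\mathfrak{g}}(y),\nabla_x z\rangle$ and $\alpha_{\mathfrak{g}}(\nabla_x y)=\nabla_{\alpha_{\mathfrak{g}}(x)}\alpha_{\mathfrak{g}}(y)$. The curvature tensor is $R(x,y)z=\nabla_{\alpha_{\mathfrak{g}}(x)}\nabla_y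 z-\nabla_{\alpha_{\mathfrak{g}}(y)}\nabla_x z-\nabla_{[x,y]_{\mathfrak{g}}}\alpha_{\mathfrak{g}}(z)$, and the Ricci curvature is $\mathrm{Ric}(x,y)=\mathrm{tr}\big(z\mapsto R(z,x)y\big)$. A vector $v\in\mathfrak{g}$ is Killing if $\langle\nabla_x v,\alpha_{\mathfrak{g}}(y)\rangle=-\langle\nabla_y v,\alpha_{\mathfrak{g}}(x)\rangle$ for all $x,y\in\mathfrak{g}$. *)

theory Defs
  imports "HOL-Analysis.Analysis"
begin

text \<open>The underlying vector space is the whole of a type of class \<open>real_vector\<close>; finite
  dimensionality is a locale assumption. This keeps the form independent of any inner product
  attached to the type, and it allows the zero space, which \<open>euclidean_space\<close> excludes.\<close>

locale hom_lie_algebra =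
  fixes bracket :: "'a::real_vector \<Rightarrow> 'a \<Rightarrow> 'a"
    and \<alpha> :: "'a \<Rightarrow> 'a"
  assumes finite_dimensional: "\<exists>B :: 'a set. finite B \<and> span B = UNIV"
    and bilinear_bracket: "bilinear bracket"
    and skew_symmetric: "bracket x y = - bracket y x"
    and linear_twist: "linear \<alpha>"
    and twist_bracket: "\<alpha> (bracket x y) = bracket (\<alpha> x) (\<alpha> y)"
    and hom_jacobi: "bracket (\<alpha> x) (bracket y z) + bracket (\<alpha> y) (bracket z x)
          + bracket (\<alpha> z) (bracket x y) = 0"

locale pseudo_riemannian_hom_lie_algebra = hom_lie_algebra bracket \<alpha>
  for bracket :: "'a::real_vector \<Rightarrow> 'a \<Rightarrow> 'a" and \<alpha> :: "'a \<Rightarrow> 'a" +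
  fixes form :: "'a \<Rightarrow> 'a \<Rightarrow> real"
  assumes bilinear_metric: "bilinear form"
    and metric_symmetric: "form x y = form y x"
    and metric_nondegenerate: "(\<And>y. form x y = 0) \<Longrightarrow> x = 0"
    and metric_twist: "form (\<alpha> x) (\<alpha> y) = form x y"

locale riemannian_hom_lie_algebra = pseudo_riemannian_hom_lie_algebra +
  assumes metric_pos_def: "x \<noteq> 0 \<Longrightarrow> 0 < form x x"

locale involutive_riemannian_hom_lie_algebra = riemannian_hom_lie_algebra +
  assumes involutive: "\<alpha> (\<alpha> x) = x"

definition koszul ::
  "('a::real_vector \<Rightarrow> 'a \<Rightarrow> 'a) \<Rightarrow> ('a \<Rightarrow> 'a) \<Rightarrow> ('a \<Rightarrow> 'a \<Rightarrow> real) \<Rightarrow> ('a \<Rightarrow> 'a \<Rightarrow> 'a) \<Rightarrow> bool"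
  where "koszul bracket \<alpha> form D \<longleftrightarrow> (\<forall>x y z.
    2 * form (D x y) (\<alpha> z) =
      form (bracket x y) (\<alpha> z) + form (bracket z y) (\<alpha> x) + form (bracket z x) (\<alpha> y))"

definition hom_levi_civita ::
  "('a::real_vector \<Rightarrow> 'a \<Rightarrow> 'a) \<Rightarrow> ('a \<Rightarrow> 'a) \<Rightarrow> ('a \<Rightarrow> 'a \<Rightarrow> real) \<Rightarrow> 'a \<Rightarrow> 'a \<Rightarrow> 'a"
  where "hom_levi_civita bracket \<alpha> form = (THE D. bilinear D \<and> koszul bracket \<alpha> form D)"

definition curvature ::
  "('a::real_vector \<Rightarrow> 'a \<Rightarrow> 'a) \<Rightarrow> ('a \<Rightarrow> 'a) \<Rightarrow> ('a \<Rightarrow> 'a \<Rightarrow> real) \<Rightarrow> 'a \<Rightarrow> 'a \<Rightarrow> 'a \<Rightarrow> 'a"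
  where "curvature bracket \<alpha> form x y z =
    (let D = hom_levi_civita bracket \<alpha> form
     in D (\<alpha> x) (D y z) - D (\<alpha> y) (D x z) - D (bracket x y) (\<alpha> z))"

text \<open>The sum of the diagonal coefficients with respect to some basis; lemma
  \<open>linear_trace_basis\<close> shows that the choice of basis does not matter.\<close>

definition linear_trace :: "('a::real_vector \<Rightarrow> 'a) \<Rightarrow> real"
  where "linear_trace f =
    (let B = (SOME B. independent B \<and> span B = UNIV) in \<Sum>b\<in>B. representation B (f b) b)"

definition ricci ::
  "('a::real_vector \<Rightarrow> 'a \<Rightarrow> 'a) \<Rightarrow> ('a \<Rightarrow> 'a) \<Rightarrow> ('a \<Rightarrow> 'a \<Rightarrow> real) \<Rightarrow> 'a \<Rightarrow> 'a \<Rightarrow> real"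
  where "ricci bracket \<alpha> form x y = linear_trace (\<lambda>z. curvature bracket \<alpha> form z x y)"

definition killing ::
  "('a::real_vector \<Rightarrow> 'a \<Rightarrow> 'a) \<Rightarrow> ('a \<Rightarrow> 'a) \<Rightarrow> ('a \<Rightarrow> 'a \<Rightarrow> real) \<Rightarrow> 'a \<Rightarrow> bool"
  where "killing bracket \<alpha> form v \<longleftrightarrow> (\<forall>x y.
    form (hom_levi_civita bracket \<alpha> form x v) (\<alpha> y) =
      - form (hom_levi_civita bracket \<alpha> form y v) (\<alpha> x))"

lemma finite_basis:
  fixes B C :: "'a::real_vector set"
  assumes "finite C" "span C = UNIV" "independent B"
  shows "finite B"
  using real_vector.independent_span_bound[of C B] assms by simp

lemma sum_representation_UNIV:
  fixes B :: "'a::real_vector set"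
  assumes "finite B" "independent B" "span B = UNIV"
  shows "(\<Sum>b\<in>B. representation B v b *\<^sub>R b) = v"
  using real_vector.sum_representation_eq[of B v B] assms by auto

lemma representation_linear_sum:
  fixes f :: "'a::real_vector \<Rightarrow> 'a"
  assumes "linear f" "finite B" "independent B" "span B = UNIV" "independent C" "span C = UNIV"
  shows "representation C (f v) c = (\<Sum>b\<in>B. representation B v b * representation C (f b) c)"
proof -
  have "f v = (\<Sum>b\<in>B. representation B v b *\<^sub>R f b)"
    using arg_cong[OF sum_representation_UNIV[of B v], of f] assms
    by (simp add: linear_sum linear_scale)
  then show ?thesis
    using assms by (simp add: real_vector.representation_sum real_vector.representation_scale)
qed

lemma linear_trace_basis:
  fixes f :: "'a::real_vector \<Rightarrow> 'a"
  assumes f: "linear f" and B: "finite B" "independent B" "span B = UNIV"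
  shows "linear_trace f = (\<Sum>b\<in>B. representation B (f b) b)"
proof -
  define C :: "'a set" where "C = (SOME C. independent C \<and> span C = UNIV)"
  have C: "independent C \<and> span C = UNIV"
    unfolding C_def by (rule someI[of _ B]) (use B in blast)
  have fC: "finite C" using finite_basis[OF B(1,3)] C by blast
  have "linear_trace f = (\<Sum>c\<in>C. representation C (f c) c)"
    by (simp add: linear_trace_def C_def Let_def)
  also have "\<dots> = (\<Sum>c\<in>C. \<Sum>b\<in>B. representation B c b * representation C (f b) c)"
    using C by (intro sum.cong refl representation_linear_sum[OF f B]) auto
  also have "\<dots> = (\<Sum>b\<in>B. \<Sum>c\<in>C. representation C (f b) c * representation B c b)"
    by (subst sum.swap) (simp add: mult.commute)
  also have "\<dots> = (\<Sum>b\<in>B. representation B (f b) b)"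
    using C by (intro sum.cong refl
        representation_linear_sum[OF linear_id fC _ _ B(2,3), unfolded id_def, symmetric]) auto
  finally show ?thesis .
qed

context pseudo_riemannian_hom_lie_algebra
begin

lemma twist_surj: "surj \<alpha>"
proof -
  obtain C :: "'a set" where C: "finite C" "span C = UNIV" using finite_dimensional by blast
  obtain B :: "'a set" where B: "independent B" "span B = UNIV"
    using real_vector.independent_extend_basis[of "{}"] real_vector.span_extend_basis[of "{}"]
      real_vector.independent_empty by blast
  interpret fd: finite_dimensional_vector_space_pair
    "scaleR :: real \<Rightarrow> 'a \<Rightarrow> 'a" B "scaleR :: real \<Rightarrow> 'a \<Rightarrow> 'a" B
    by unfold_locales (use B finite_basis[OF C B(1)] in
      \<open>auto simp: dependent_raw_def span_raw_def\<close>)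
  have "x = 0" if "\<alpha> x = 0" for x
    using that metric_twist[of x] bilinear_lzero[OF bilinear_metric]
    by (intro metric_nondegenerate) metis
  then have "inj \<alpha>" using linear_inj_iff_eq_0[OF linear_twist] by blast
  then show ?thesis
    using fd.linear_injective_imp_surjective linear_twist by (simp add: linear_def)
qed

lemma metric_represents:
  fixes \<phi> :: "'a \<Rightarrow> real"
  assumes \<phi>: "linear \<phi>"
  shows "\<exists>w. \<forall>z. form w z = \<phi> z"
proof -
  obtain C :: "'a set" where C: "finite C" "span C = UNIV" using finite_dimensional by blast
  obtain B :: "'a set" where B: "independent B" "span B = UNIV"
    using real_vector.independent_extend_basis[of "{}"] real_vector.span_extend_basis[of "{}"]
      real_vector.independent_empty by blast
  have fB: "finite B" using finite_basis[OF C B(1)] .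
  interpret fd: finite_dimensional_vector_space_pair
    "scaleR :: real \<Rightarrow> 'a \<Rightarrow> 'a" B "scaleR :: real \<Rightarrow> 'a \<Rightarrow> 'a" B
    by unfold_locales (use B fB in \<open>auto simp: dependent_raw_def span_raw_def\<close>)
  define T where "T = (\<lambda>w. \<Sum>b\<in>B. form w b *\<^sub>R b)"
  have rep: "representation B (\<Sum>b\<in>B. c b *\<^sub>R b) a = c a" if "a \<in> B" for a and c :: "'a \<Rightarrow> real"
    using B fB that
    by (simp add: real_vector.representation_sum real_vector.representation_scale
        real_vector.representation_basis if_distrib sum.delta cong: if_cong)
  have ext: "form w = \<psi>" if "linear \<psi>" "\<And>b. b \<in> B \<Longrightarrow> form w b = \<psi> b" for w \<psi>
    using linear_eq_on_span[of "form w" \<psi> B] that B(2) bilinear_metric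
    by (auto simp: bilinear_def)
  have "linear T"
    unfolding T_def
    by (rule linearI) (simp_all add: bilinear_ladd[OF bilinear_metric]
        bilinear_lmul[OF bilinear_metric] scaleR_left_distrib sum.distrib scaleR_sum_right)
  moreover have "w = 0" if "T w = 0" for w
  proof -
    have "form w b = 0" if "b \<in> B" for b
      using rep[OF that, of "form w"] \<open>T w = 0\<close>
      by (simp add: T_def real_vector.representation_zero)
    then have "form w = (\<lambda>_. 0)" by (intro ext) (auto intro: linearI)
    then show ?thesis by (intro metric_nondegenerate) simp
  qed
  ultimately have "surj T"
    using fd.linear_injective_imp_surjective[of T] linear_inj_iff_eq_0[of T]
    by (simp add: linear_def)
  then obtain w where "T w = (\<Sum>b\<in>B. \<phi> b *\<^sub>R b)" by (metis surjD)
  then have "form w b = \<phi> b" if "b \<in> B" for b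
    using rep[OF that, of "form w"] rep[OF that, of \<phi>] by (simp add: T_def)
  then show ?thesis using ext[OF \<phi>] by metis
qed

lemma metric_eqI: "(\<And>z. form x (\<alpha> z) = form y (\<alpha> z)) \<Longrightarrow> x = y"
  using metric_nondegenerate[of "x - y"] twist_surj
  by (metis bilinear_lsub[OF bilinear_metric] eq_iff_diff_eq_0 surjD)

lemma ex1_koszul: "\<exists>!D. bilinear D \<and> koszul bracket \<alpha> form D"
proof -
  note bm = bilinear_metric and bb = bilinear_bracket
  note lin = bilinear_ladd[OF bm] bilinear_radd[OF bm] bilinear_lmul[OF bm] bilinear_rmul[OF bm]
    bilinear_ladd[OF bb] bilinear_radd[OF bb] bilinear_lmul[OF bb] bilinear_rmul[OF bb]
    linear_add[OF linear_twist] linear_scale[OF linear_twist]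
  define K where "K x y z = (form (bracket x y) (\<alpha> z) + form (bracket z y) (\<alpha> x)
    + form (bracket z x) (\<alpha> y)) / 2" for x y z
  have "\<exists>w. \<forall>z. form w (\<alpha> z) = K x y z" for x y
  proof -
    have inj: "inj \<alpha>"
      unfolding linear_inj_iff_eq_0[OF linear_twist]
      by (metis metric_nondegenerate metric_twist bilinear_lzero[OF bm])
    have "linear (\<lambda>z. K x y (inv \<alpha> z))"
    proof (rule linearI)
      show "K x y (inv \<alpha> (a + b)) = K x y (inv \<alpha> a) + K x y (inv \<alpha> b)" for a b
      proof -
        have "\<alpha> (inv \<alpha> a + inv \<alpha> b) = a + b"
          by (simp add: linear_add[OF linear_twist] surj_f_inv_f twist_surj)
        then have "inv \<alpha> (a + b) = inv \<alpha> a + inv \<alpha> b" using inj by (metis inv_f_f)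
        then show ?thesis by (simp add: K_def lin add_divide_distrib)
      qed
      show "K x y (inv \<alpha> (r *\<^sub>R a)) = r *\<^sub>R K x y (inv \<alpha> a)" for r a
      proof -
        have "\<alpha> (r *\<^sub>R inv \<alpha> a) = r *\<^sub>R a"
          by (simp add: linear_scale[OF linear_twist] surj_f_inv_f twist_surj)
        then have "inv \<alpha> (r *\<^sub>R a) = r *\<^sub>R inv \<alpha> a" using inj by (metis inv_f_f)
        then show ?thesis by (simp add: K_def lin algebra_simps)
      qed
    qed
    from metric_represents[OF this] inj show ?thesis by (metis inv_f_f)
  qed
  then obtain D where D: "\<And>x y z. form (D x y) (\<alpha> z) = K x y z" by metis
  have "bilinear D"
    unfolding bilinear_def
    by (intro conjI allI linearI metric_eqI) (simp_all add: D K_def lin field_simps)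
  moreover have "koszul bracket \<alpha> form D"
    by (simp add: koszul_def D K_def)
  moreover have "D' = D" if "koszul bracket \<alpha> form D'" for D'
  proof (intro ext metric_eqI)
    fix x y z
    show "form (D' x y) (\<alpha> z) = form (D x y) (\<alpha> z)"
      using that[unfolded koszul_def, rule_format, of x y z] by (simp add: D K_def)
  qed
  ultimately show ?thesis by blast
qed

lemma hom_levi_civita:
  shows bilinear_hom_levi_civita: "bilinear (hom_levi_civita bracket \<alpha> form)"
    and koszul_hom_levi_civita: "koszul bracket \<alpha> form (hom_levi_civita bracket \<alpha> form)"
  using theI'[OF ex1_koszul] by (simp_all add: hom_levi_civita_def)

end

end

theory Submission
  imports Defs
begin

text \<open>For an involutive twist, composing the bracket and the connection with \<open>\<alpha>\<close> turns the Hom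
  structure into an ordinary Lie algebra with its Levi-Civita connection, without changing the
  curvature. Put \<open>S z = \<alpha> (\<nabla>\<^sub>z v)\<close> and \<open>M z = \<alpha> (\<nabla>\<^sub>v z)\<close>. A vector \<open>v\<close> is Killing iff \<open>S\<close> is
  skew-adjoint, and then \<open>\<nabla>\<^sub>v v = 0\<close>, so \<open>R(z,v)v = - M S z - S (S z - M z)\<close>. Taking traces gives
  Bochner's identity \<open>Ric(v,v) = - tr (S\<^sup>2) = tr (S\<^sup>* S)\<close>, which is nonnegative and vanishes only
  if \<open>S = 0\<close>.\<close>

text \<open>In matrix entries with respect to \<open>B\<close> both sides are the same double sum,
  with the order of summation exchanged.\<close>

lemma linear_trace_commute:
  fixes f g :: "'a::real_vector \<Rightarrow> 'a"
  assumes f: "linear f" and g: "linear g"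
    and B: "finite B" "independent B" "span (B :: 'a set) = UNIV"
  shows "linear_trace (\<lambda>x. f (g x)) = linear_trace (\<lambda>x. g (f x))"
proof -
  have tr: "linear_trace (\<lambda>x. p (q x)) =
      (\<Sum>b\<in>B. \<Sum>c\<in>B. representation B (q b) c * representation B (p c) b)"
    if "linear p" "linear q" for p q :: "'a \<Rightarrow> 'a"
    unfolding linear_trace_basis[OF linear_compose[OF that(2,1), unfolded o_def] B]
    by (intro sum.cong refl representation_linear_sum[OF that(1) B B(2,3)])
  show ?thesis
    unfolding tr[OF f g] tr[OF g f] by (subst sum.swap) (simp add: mult.commute)
qed

context riemannian_hom_lie_algebra
begin

lemmas metric_simps =
  bilinear_ladd[OF bilinear_metric] bilinear_radd[OF bilinear_metric]
  bilinear_lmul[OF bilinear_metric] bilinear_rmul[OF bilinear_metric]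
  bilinear_lsub[OF bilinear_metric] bilinear_rsub[OF bilinear_metric]
  bilinear_lneg[OF bilinear_metric] bilinear_rneg[OF bilinear_metric]
  bilinear_lzero[OF bilinear_metric] bilinear_rzero[OF bilinear_metric]

lemma metric_sum_left: "form (sum f A) y = (\<Sum>a\<in>A. form (f a) y)"
proof -
  have "linear (\<lambda>x. form x y)" using bilinear_metric by (simp add: bilinear_def)
  then show ?thesis by (rule linear_sum)
qed

lemma metric_nonneg: "0 \<le> form x x"
  using metric_pos_def[of x] by (cases "x = 0") (auto simp: metric_simps)

text \<open>Gram-Schmidt for \<open>form\<close> without normalisation, by induction on the spanning
  set.\<close>

lemma orthogonal_basis_of_span:
  assumes "finite C"
  shows "\<exists>B. finite B \<and> 0 \<notin> B \<and> pairwise (\<lambda>a b. form a b = 0) B \<and> span B = span C"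
  using assms
proof (induction C)
  case empty
  then show ?case by (intro exI[of _ "{}"]) auto
next
  case (insert x C)
  then obtain B where B: "finite B" "0 \<notin> B" "pairwise (\<lambda>a b. form a b = 0) B" "span B = span C"
    by blast
  \<comment> \<open>The orthogonal projection of \<open>x\<close> onto \<open>span B\<close>; the
    remainder \<open>x - p\<close> is the candidate for a new basis vector.\<close>
  define p where "p = (\<Sum>b\<in>B. (form x b / form b b) *\<^sub>R b)"
  have "p \<in> span B" unfolding p_def by (intro span_sum span_scale span_base)
  then have "span (insert (x - p) B) = span (insert x B)"
    by (intro eq_span_insert_eq) (simp add: span_neg)
  also have "\<dots> = span (insert x C)" using B(4) by (simp add: span_insert)
  finally have sp: "span (insert (x - p) B) = span (insert x C)" .
  have orth: "form (x - p) b = 0" if "b \<in> B" for b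
  proof -
    have "form b b \<noteq> 0" using B(2) that metric_pos_def[of b] by force
    moreover have "form p b = (\<Sum>c\<in>B. if c = b then form x b else 0)"
      unfolding p_def metric_sum_left
    proof (intro sum.cong refl)
      fix c assume "c \<in> B"
      then show "form ((form x c / form c c) *\<^sub>R c) b = (if c = b then form x b else 0)"
        using B(3) that \<open>form b b \<noteq> 0\<close> by (auto simp: metric_simps pairwise_def)
    qed
    ultimately show ?thesis using B(1) that by (simp add: metric_simps)
  qed
  show ?case
  \<comment> \<open>A zero remainder means that \<open>x\<close> already lies in
    \<open>span B\<close>; then \<open>B\<close> is kept, so that \<open>0\<close> stays out of
    it.\<close>
  proof (cases "x - p = 0")
    case True
    then show ?thesis
      using sp B by (intro exI[of _ B]) auto
  next
    case False
    then show ?thesis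
      using sp B orth metric_symmetric
      by (intro exI[of _ "insert (x - p) B"]) (auto simp: pairwise_insert)
  qed
qed

lemma orthogonal_imp_independent:
  assumes "0 \<notin> B" and orth: "pairwise (\<lambda>a b. form a b = 0) B"
  shows "independent B"
  unfolding dependent_def
proof
  assume "\<exists>b\<in>B. b \<in> span (B - {b})"
  then obtain b where b: "b \<in> B" "b \<in> span (B - {b})" by blast
  have "linear (form b)" using bilinear_metric by (simp add: bilinear_def)
  moreover have "form b c = 0" if "c \<in> B - {b}" for c
    using orth b(1) that by (auto simp: pairwise_def)
  ultimately have "form b b = 0" using b(2) by (rule linear_eq_0_on_span)
  then show False using metric_pos_def[of b] assms(1) b(1) by auto
qed

text \<open>Pairing the expansion of \<open>x\<close> with \<open>b\<close> leaves only the
  \<open>b\<close> term, so coordinates are Fourier coefficients. Traces thereby become sums of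
  \<open>form (f b) b / form b b\<close>.\<close>

lemma ex_orthogonal_basis:
  obtains B where "finite B" "independent B" "span B = UNIV"
    "\<And>x b. b \<in> B \<Longrightarrow> representation B x b = form x b / form b b"
proof -
  obtain C :: "'a set" where "finite C" "span C = UNIV" using finite_dimensional by blast
  then obtain B where B: "finite B" "0 \<notin> B" "pairwise (\<lambda>a b. form a b = 0) B" "span B = UNIV"
    using orthogonal_basis_of_span by metis
  have ind: "independent B" using orthogonal_imp_independent B(2,3) .
  have "representation B x b = form x b / form b b" if b: "b \<in> B" for x b
  proof -
    have "form x b = (\<Sum>c\<in>B. representation B x c * form c b)"
      using arg_cong[OF sum_representation_UNIV[OF B(1) ind B(4), of x], of "\<lambda>y. form y b"]
      by (simp add: metric_sum_left metric_simps)
    also have "\<dots> = (\<Sum>c\<in>B. if c = b then representation B x b * form b b else 0)"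
      using B(3) b by (intro sum.cong refl) (auto simp: pairwise_def)
    finally have "form x b = representation B x b * form b b" using B(1) b by simp
    moreover have "form b b \<noteq> 0" using B(2) b metric_pos_def[of b] by force
    ultimately show ?thesis by simp
  qed
  with that B ind show thesis by blast
qed

text \<open>In an orthogonal basis skewness turns the diagonal entries of the square of
  \<open>S\<close> into \<open>- form (S b) (S b) / form b b\<close>. If these nonpositive terms sum
  to zero, each vanishes, and \<open>S\<close> is zero on a basis.\<close>

lemma skew_adjoint_trace_square:
  assumes S: "linear S" and skew: "\<And>x y. form (S x) y = - form x (S y)"
  shows "linear_trace (\<lambda>x. S (S x)) \<le> 0"
    and "0 \<le> linear_trace (\<lambda>x. S (S x)) \<Longrightarrow> S x = 0"
proof -
  obtain B where B: "finite B" "independent B" "span B = UNIV"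
    "\<And>x b. b \<in> B \<Longrightarrow> representation B x b = form x b / form b b"
    using ex_orthogonal_basis by blast
  have tr: "linear_trace (\<lambda>x. S (S x)) = - (\<Sum>b\<in>B. form (S b) (S b) / form b b)"
    using linear_compose[OF S S]
    by (simp add: o_def linear_trace_basis[OF _ B(1-3)] B(4) skew sum_negf)
  have nn: "0 \<le> form (S b) (S b) / form b b" for b
    by (simp add: metric_nonneg)
  then have sum_nn: "0 \<le> (\<Sum>b\<in>B. form (S b) (S b) / form b b)"
    by (simp add: sum_nonneg)
  show "linear_trace (\<lambda>x. S (S x)) \<le> 0"
    unfolding tr using sum_nn by simp
  assume "0 \<le> linear_trace (\<lambda>x. S (S x))"
  then have "(\<Sum>b\<in>B. form (S b) (S b) / form b b) = 0"
    unfolding tr using sum_nn by simp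
  then have "form (S b) (S b) / form b b = 0" if "b \<in> B" for b
    using sum_nonneg_eq_0_iff[OF B(1), of "\<lambda>b. form (S b) (S b) / form b b"] nn that by simp
  \<comment> \<open>For nonzero \<open>b\<close> the denominator \<open>form b b\<close> is
    positive, so a zero quotient has a zero numerator.\<close>
  moreover have "b \<noteq> 0" if "b \<in> B" for b using B(2) that dependent_zero by blast
  ultimately have "S b = 0" if "b \<in> B" for b
    using that metric_pos_def[of b] metric_pos_def[of "S b"] by force
  then show "S x = 0"
    using linear_eq_0_on_span[OF S, of B x] B(3) by simp
qed

end

context involutive_riemannian_hom_lie_algebra
begin

abbreviation nabla :: "'a \<Rightarrow> 'a \<Rightarrow> 'a"
  where "nabla \<equiv> hom_levi_civita bracket \<alpha> form"

text \<open>An isometry that is its own inverse is self-adjoint.\<close>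

lemma metric_twist_shift: "form (\<alpha> x) y = form x (\<alpha> y)"
  using metric_twist[of x "\<alpha> y"] by (simp add: involutive)

lemma koszul_nabla:
  "2 * form (nabla x y) (\<alpha> z) =
    form (bracket x y) (\<alpha> z) + form (bracket z y) (\<alpha> x) + form (bracket z x) (\<alpha> y)"
  using koszul_hom_levi_civita by (simp add: koszul_def)

text \<open>Exchanging \<open>x\<close> and \<open>y\<close> in the Koszul formula permutes the last
  two terms and negates the first, so the difference is twice the first.\<close>

lemma bracket_eq_nabla: "bracket x y = nabla x y - nabla y x"
proof (rule metric_eqI)
  fix z
  show "form (bracket x y) (\<alpha> z) = form (nabla x y - nabla y x) (\<alpha> z)"
    using koszul_nabla[of x y z] koszul_nabla[of y x z]
    by (simp add: skew_symmetric[of y x] metric_simps)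
qed

text \<open>Since \<alpha> preserves \<open>form\<close> and the bracket, both sides have equal
  Koszul expressions; testing the left one against \<open>z\<close> amounts to the Koszul formula at
  \<open>\<alpha> z\<close>.\<close>

lemma twist_nabla: "\<alpha> (nabla x y) = nabla (\<alpha> x) (\<alpha> y)"
proof (rule metric_eqI)
  fix z
  show "form (\<alpha> (nabla x y)) (\<alpha> z) = form (nabla (\<alpha> x) (\<alpha> y)) (\<alpha> z)"
    using koszul_nabla[of x y "\<alpha> z"] koszul_nabla[of "\<alpha> x" "\<alpha> y" z]
      metric_twist[of "bracket x y" z] metric_twist_shift[of "bracket (\<alpha> z) y" x]
      metric_twist_shift[of "bracket (\<alpha> z) x" y]
    by (simp add: involutive metric_twist twist_bracket)
qed

lemma ricci_killing:
  assumes "killing bracket \<alpha> form v"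
  defines "S \<equiv> \<lambda>x. \<alpha> (nabla x v)"
  shows "linear S" and "form (S x) y = - form x (S y)"
    and "ricci bracket \<alpha> form v v = - linear_trace (\<lambda>x. S (S x))"
proof -
  define M where "M = (\<lambda>x. \<alpha> (nabla v x))"
  note bn = bilinear_hom_levi_civita
  show S: "linear S"
    unfolding S_def by (intro linear_compose[OF _ linear_twist, unfolded o_def])
      (use bn in \<open>simp add: bilinear_def\<close>)
  have M: "linear M"
    unfolding M_def by (intro linear_compose[OF _ linear_twist, unfolded o_def])
      (use bn in \<open>simp add: bilinear_def\<close>)
  \<comment> \<open>Self-adjointness of \<alpha> rewrites
    \<open>form (nabla x v) (\<alpha> y)\<close> as \<open>form (S x) y\<close>, which makes the
    Killing equation skewness of \<open>S\<close>.\<close>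
  show skew: "form (S x) y = - form x (S y)" for x y
    using assms(1) unfolding S_def killing_def
    by (metis metric_twist_shift metric_symmetric)
  \<comment> \<open>In the Koszul formula at \<open>x\<close>, \<open>v\<close>, \<open>v\<close>
    the terms with \<open>bracket x v\<close> and \<open>bracket v x\<close> cancel and
    \<open>bracket v v\<close> is zero. Skewness then carries this over to
    \<open>S v\<close>.\<close>
  have "form (S x) v = 0" for x
  proof -
    have "form (bracket a b) c = - form (bracket b a) c" for a b c
      using skew_symmetric[of a b] by (simp add: bilinear_lneg[OF bilinear_metric])
    from this[of v v "\<alpha> x"] this[of x v "\<alpha> v"] show ?thesis
      using koszul_nabla[of x v v] unfolding S_def metric_twist_shift by linarith
  qed
  then have "form (S v) x = 0" for x
    using skew[of v x] metric_symmetric by simp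
  then have "S v = 0" by (rule metric_nondegenerate)
  then have vv: "nabla v v = 0"
    using involutive[of "nabla v v"] by (simp add: S_def linear_0[OF linear_twist])
  have "curvature bracket \<alpha> form z v v = - M (S z) - S (S z) + S (M z)" for z
  proof -
    \<comment> \<open>Inserting the identity as \<alpha> applied twice lets
      \<open>twist_nabla\<close> pull one \<alpha> out of the connection.\<close>
    have "nabla (\<alpha> v) (nabla z v) = M (S z)"
      by (simp add: M_def S_def twist_nabla involutive)
    moreover have "nabla (bracket z v) (\<alpha> v) = S (\<alpha> (bracket z v))"
      by (simp add: S_def twist_nabla involutive)
    moreover have "\<alpha> (bracket z v) = S z - M z"
      by (simp add: bracket_eq_nabla S_def M_def linear_diff[OF linear_twist])
    ultimately show ?thesis
      by (simp add: curvature_def vv bilinear_rzero[OF bn] linear_diff[OF S])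
  qed
  moreover obtain B :: "'a set" where B: "finite B" "independent B" "span B = UNIV"
    by (rule ex_orthogonal_basis) (rule that)
  note lins = linear_compose[OF S M] linear_compose[OF S S] linear_compose[OF M S]
  have "linear (\<lambda>z. - M (S z) - S (S z) + S (M z))"
    using linear_compose_neg[OF lins(1), THEN linear_compose_sub[OF _ lins(2)],
        THEN linear_compose_add[OF _ lins(3)]]
    by (simp add: o_def)
  then have "linear_trace (\<lambda>z. - M (S z) - S (S z) + S (M z)) =
     - linear_trace (\<lambda>z. M (S z)) - linear_trace (\<lambda>z. S (S z)) + linear_trace (\<lambda>z. S (M z))"
    using lins B unfolding o_def
    by (simp add: linear_trace_basis[OF _ B] representation_add representation_diff
        representation_neg sum.distrib sum_subtractf sum_negf)
  \<comment> \<open>The products of \<open>M\<close> and \<open>S\<close> in either order have equal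
    trace and enter with opposite signs.\<close>
  ultimately show "ricci bracket \<alpha> form v v = - linear_trace (\<lambda>x. S (S x))"
    by (simp add: ricci_def linear_trace_commute[OF M S B])
qed

end

theorem theorem10:
  fixes bracket :: "'a::real_vector \<Rightarrow> 'a \<Rightarrow> 'a"
    and \<alpha> :: "'a \<Rightarrow> 'a"
    and form :: "'a \<Rightarrow> 'a \<Rightarrow> real"
  assumes "involutive_riemannian_hom_lie_algebra bracket \<alpha> form"
  shows "((\<forall>x. x \<noteq> 0 \<longrightarrow> ricci bracket \<alpha> form x x < 0) \<longrightarrow>
           \<not> (\<exists>v. v \<noteq> 0 \<and> killing bracket \<alpha> form v)) \<and>
         ((\<forall>x. ricci bracket \<alpha> form x x \<le> 0) \<longrightarrow>
           (\<forall>v. killing bracket \<alpha> form v \<longrightarrow>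
             (\<forall>x. hom_levi_civita bracket \<alpha> form x v = 0)))"
proof -
  interpret involutive_riemannian_hom_lie_algebra bracket \<alpha> form by fact
  have "0 \<le> ricci bracket \<alpha> form v v" if "killing bracket \<alpha> form v" for v
    using ricci_killing[OF that] skew_adjoint_trace_square(1) by fastforce
  moreover have "nabla x v = 0"
    if k: "killing bracket \<alpha> form v" and r: "ricci bracket \<alpha> form v v \<le> 0" for v x
  proof -
    \<comment> \<open>By Bochner's identity the sign of \<open>ricci\<close> in \<open>r\<close>
      makes the trace of the square of \<open>S\<close> nonnegative, which is the equality
      case.\<close>
    have "\<alpha> (nabla x v) = 0"
      using skew_adjoint_trace_square(2)[OF ricci_killing(1,2)[OF k]] ricci_killing(3)[OF k] r
      by simp
    then show ?thesis
      using involutive[of "nabla x v"] by (simp add: linear_0[OF linear_twist])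
  qed
  ultimately show ?thesis by (meson not_le)
qed

end
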